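(* Let $\alpha,\beta\in\mathbb{R}$. The sequence $\{k^2+\alpha k+\beta\}_{k=0}^{\infty}$ is a Legendre multiplier sequence if and only if $\alpha=1$ and $\beta\in[0,1]$.
   Context: The Legendre polynomials $\mathfrak{Le}_n(x)$ are defined by $\frac{1}{\sqrt{1-2xt+t^2}}=\sum_{k=0}^{\infty}\mathfrak{Le}_k(x)t^k$. A real sequence $\{\gamma_k\}_{k=0}^{\infty}$ is a Legendre multiplier sequence if, for every $n$ and all real $a_0,\dots,a_n$, the polynomial $\sum_{k=0}^n a_k\gamma_k\mathfrak{Le}_k(x)$ has only real zeros whenever $\sum_{k=0}^n a_k\mathfrak{Le}_k(x)$ has only real zeros. *)

theory Defs
  imports "HOL-Computational_Algebra.Computational_Algebra"
begin

text \<open>Generating function of the Legendre polynomials, as a formal power series in t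
whose coefficients are real polynomials in x:
  (1 - 2 x t + t^2)^(-1/2) = (1 + u)^(-1/2) with u = t^2 - 2 x t = t (t - 2x),
expanded by the binomial series  sum_n ((-1/2) gchoose n) u^n  (u has zero constant term).\<close>

definition legendre_gen :: "real poly fps" where
  "legendre_gen =
     Abs_fps (\<lambda>n. [: (-1/2 :: real) gchoose n :])
       oo (fps_X * (fps_X - fps_const [:0, 2:]))"

definition Le :: "nat \<Rightarrow> real poly" where
  "Le k = legendre_gen $ k"

text \<open>A real polynomial has only real zeros. The zero polynomial is counted as having
only real zeros (standard convention; needed e.g. when gamma_0 = 0).\<close>
definition only_real_zeros :: "real poly \<Rightarrow> bool" where
  "only_real_zeros p \<longleftrightarrow>
     p = 0 \<or> (\<forall>z::complex. poly (map_poly complex_of_real p) z = 0 \<longrightarrow> Im z = 0)"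

definition legendre_multiplier_sequence :: "(nat \<Rightarrow> real) \<Rightarrow> bool" where
  "legendre_multiplier_sequence \<gamma> \<longleftrightarrow>
     (\<forall>(n::nat) (a::nat \<Rightarrow> real).
        only_real_zeros (\<Sum>k\<le>n. smult (a k) (Le k)) \<longrightarrow>
        only_real_zeros (\<Sum>k\<le>n. smult (a k * \<gamma> k) (Le k)))"

end

theory Submission
  imports Defs
begin

text \<open>
  By Legendre's equation the sequence \<open>k\<^sup>2 + k + \<beta>\<close> acts on Legendre expansions as the operator
  \<open>T = (x\<^sup>2 - 1) D\<^sup>2 + 2 x D + \<beta>\<close>. For \<open>0 \<le> \<beta> \<le> 1\<close> its symbol is stable, and a two-step
  argument in the style of Lieb and Sokal, using only that \<open>p'/p\<close> maps the upper half-plane to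
  the lower one when the zeros of \<open>p\<close> are real, shows that \<open>T p\<close> has no zeros off the real line.
  Conversely, the image of \<open>x\<^sup>6\<close> violates Laguerre's inequality at \<open>0\<close> unless \<open>\<alpha> = 1\<close>; then
  \<open>x\<^sup>2 - c\<^sup>2\<close> and \<open>x (x\<^sup>2 - c\<^sup>2)\<close> force \<open>\<beta> \<ge> 0\<close>, and \<open>(x - c)\<^sup>n\<close> with \<open>n\<close> and \<open>c\<close> large forces
  \<open>\<beta> \<le> 1\<close>.
\<close>

section \<open>Legendre polynomials\<close>

text \<open>The factor \<open>F\<close> is the binomial series of exponent -1/2, so
  \<open>(1 + t) F' = -F/2\<close>; composing with \<open>u\<close> and using
  \<open>u' = 2t - 2x\<close> gives a linear differential equation in t.\<close>

lemma legendre_gen_deriv: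
  "(1 + fps_X * (fps_X - fps_const [:0, 2:])) * fps_deriv legendre_gen
     = (fps_const [:0, 1:] - fps_X) * legendre_gen"
proof -
  define F :: "real poly fps" where "F = Abs_fps (\<lambda>n. [: (-1/2 :: real) gchoose n :])"
  define u :: "real poly fps" where "u = fps_X * (fps_X - fps_const [:0, 2:])"
  have G: "legendre_gen = F oo u"
    by (simp add: legendre_gen_def F_def u_def)
  have u0: "u $ 0 = 0"
    by (simp add: u_def)
  have "(1 + fps_X) * fps_deriv F = fps_const [:-1/2:] * F"
  proof (rule fps_ext)
    fix n
    have "real (Suc n) * ((-1/2) gchoose Suc n) + real n * ((-1/2) gchoose n)
            = (-1/2) * ((-1/2 :: real) gchoose n)"
      using gbinomial_mult_1[of "-1/2 :: real" n] by simp
    then show "((1 + fps_X) * fps_deriv F) $ n = (fps_const [:-1/2:] * F) $ n"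
      by (cases n) (simp_all add: F_def distrib_right of_nat_poly add.commute mult.commute)
  qed
  then have "((1 + fps_X) * fps_deriv F) oo u = (fps_const [:-1/2:] * F) oo u"
    by simp
  then have F': "(1 + u) * (fps_deriv F oo u) = fps_const [:-1/2:] * legendre_gen"
    by (simp add: fps_compose_mult_distrib[OF u0] fps_compose_add_distrib G u0)
  have u': "fps_const [:-1/2:] * fps_deriv u = fps_const [:0, 1:] - fps_X"
  proof -
    have "fps_deriv u = fps_const 2 * fps_X - fps_const [:0, 2:]"
      by (simp add: u_def algebra_simps flip: numeral_fps_const)
    then have "fps_const [:-1/2:] * fps_deriv u
        = fps_const ([:-1/2:] * 2) * fps_X - fps_const ([:-1/2:] * [:0, 2:])"
      by (simp only: right_diff_distrib mult.assoc[symmetric] fps_const_mult)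
    also have "[:-1/2:] * 2 = - (1 :: real poly)"
      by (simp add: numeral_poly one_pCons)
    also have "[:-1/2:] * [:0, 2:] = - [:0, 1 :: real:]"
      by simp
    finally show ?thesis
      by (simp only: fps_const_neg[symmetric] fps_const_1_eq_1) simp
  qed
  have "(1 + u) * fps_deriv legendre_gen = (1 + u) * (fps_deriv F oo u) * fps_deriv u"
    by (simp add: G fps_compose_deriv[OF u0] mult.assoc)
  also have "\<dots> = (fps_const [:-1/2:] * fps_deriv u) * legendre_gen"
    by (simp only: F' ac_simps)
  finally show ?thesis
    unfolding u' by (simp only: u_def)
qed

lemma Le_0 [simp]: "Le 0 = 1"
  by (simp add: Le_def legendre_gen_def one_pCons)

lemma Le_Suc_0 [simp]: "Le (Suc 0) = [:0, 1:]"
  using arg_cong[OF legendre_gen_deriv, of "\<lambda>f. f $ 0"]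
  by (simp add: Le_def[symmetric])

text \<open>Bonnet's recurrence: the coefficient of \<open>t^(n+1)\<close> in the differential
  equation of the generating function.\<close>

lemma Le_recurrence:
  "of_nat (n + 2) * Le (n + 2) = of_nat (2 * n + 3) * [:0, 1:] * Le (n + 1) - of_nat (n + 1) * Le n"
proof -
  have eq: "(1 + fps_X * (fps_X - fps_const [:0, 2:])) * fps_deriv legendre_gen
     = fps_deriv legendre_gen + fps_X * (fps_X * fps_deriv legendre_gen)
       - fps_const [:0, 2:] * (fps_X * fps_deriv legendre_gen)"
    by (simp add: algebra_simps)
  have "of_nat (n + 2) * Le (n + 2) + of_nat n * Le n - [:0, 2:] * (of_nat (n + 1) * Le (n + 1))
          = [:0, 1:] * Le (n + 1) - Le n"
    using arg_cong[OF legendre_gen_deriv, of "\<lambda>f. f $ Suc n"]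
    unfolding eq left_diff_distrib
    by (cases n) (simp_all add: Le_def)
  moreover have "[:0, 2:] = 2 * [:0, 1::real:]"
    by (simp add: numeral_poly)
  ultimately show ?thesis
    by (simp add: algebra_simps)
qed

section \<open>Derivative identities and Legendre's differential equation\<close>

lemma pderiv_X: "pderiv [:0, 1::real:] = 1"
  by (simp add: pderiv_pCons one_pCons)

text \<open>The two identities need a joint induction: differentiating Bonnet's recurrence and
  eliminating \<open>pderiv P0\<close> by the second yields the next first one, and the next second
  one then follows algebraically.\<close>

lemma Le_pderiv:
  "pderiv (Le (n + 1)) = [:0, 1:] * pderiv (Le n) + of_nat (n + 1) * Le n \<and>
   [:0, 1:] * pderiv (Le (n + 1)) = pderiv (Le n) + of_nat (n + 1) * Le (n + 1)"
proof (induction n)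
  case 0
  show ?case
    by (simp add: pderiv_pCons pderiv_1)
next
  case (Suc n)
  define X :: "real poly" where "X = [:0, 1:]"
  define P0 P1 P2 where "P0 = Le n" and "P1 = Le (n + 1)" and "P2 = Le (n + 2)"
  define N :: "real poly" where "N = of_nat n"
  have A: "pderiv P1 = X * pderiv P0 + (N + 1) * P0"
    and B: "X * pderiv P1 = pderiv P0 + (N + 1) * P1"
    using Suc unfolding X_def P0_def P1_def N_def of_nat_add of_nat_1 by blast+
  have R: "(N + 2) * P2 = (2 * N + 3) * X * P1 - (N + 1) * P0"
    using Le_recurrence[of n]
    unfolding X_def P0_def P1_def P2_def N_def of_nat_add of_nat_mult of_nat_numeral of_nat_1 .
  have [simp]: "pderiv N = 0" "pderiv X = 1"
    by (simp_all add: N_def X_def pderiv_X)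
  have "pderiv ((N + 2) * P2) = pderiv ((2 * N + 3) * X * P1 - (N + 1) * P0)"
    using R by simp
  then have R': "(N + 2) * pderiv P2
      = (2 * N + 3) * P1 + (2 * N + 3) * X * pderiv P1 - (N + 1) * pderiv P0"
    by (simp add: pderiv_mult pderiv_add pderiv_diff algebra_simps)
  have "(N + 2) * pderiv P2 = (N + 2) * (X * pderiv P1 + (N + 2) * P1)"
    using R' B by algebra
  moreover have "N + 2 \<noteq> 0"
  proof -
    have "N + 2 = of_nat (n + 2)"
      by (simp add: N_def)
    then show ?thesis
      by (metis of_nat_eq_0_iff add_is_0 zero_neq_numeral)
  qed
  ultimately have A': "pderiv P2 = X * pderiv P1 + (N + 2) * P1"
    by simp
  moreover have "X * pderiv P2 = pderiv P1 + (N + 2) * P2"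
    using A B R A' by algebra
  ultimately show ?case
    by (simp add: X_def P1_def P2_def N_def add.commute)
qed

lemma Le_ode:
  "[:-1, 0, 1:] * pderiv (pderiv (Le n)) + [:0, 2:] * pderiv (Le n)
     = smult (real n ^ 2 + real n) (Le n)"
proof (cases n)
  case 0
  then show ?thesis
    by simp
next
  case (Suc m)
  define X :: "real poly" where "X = [:0, 1:]"
  define P0 P1 where "P0 = Le m" and "P1 = Le (m + 1)"
  define N :: "real poly" where "N = of_nat m"
  have A: "pderiv P1 = X * pderiv P0 + (N + 1) * P0"
    and B: "X * pderiv P1 = pderiv P0 + (N + 1) * P1"
    using Le_pderiv[of m] unfolding X_def P0_def P1_def N_def of_nat_add of_nat_1 by blast+
  have [simp]: "pderiv N = 0" "pderiv X = 1"
    by (simp_all add: N_def X_def pderiv_X)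
  \<comment> \<open>Eliminating \<open>pderiv P0\<close> between A and B leaves a first-order
    relation; its derivative is Legendre's equation once B removes \<open>pderiv P0\<close>
    again.\<close>
  have "(X * X - 1) * pderiv P1 = (N + 1) * (X * P1 - P0)"
    using A B by algebra
  then have "pderiv ((X * X - 1) * pderiv P1) = pderiv ((N + 1) * (X * P1 - P0))"
    by simp
  then have "(X * X - 1) * pderiv (pderiv P1) + 2 * X * pderiv P1
      = (N + 1) * (P1 + X * pderiv P1 - pderiv P0)"
    by (simp add: pderiv_mult pderiv_add pderiv_diff pderiv_1 algebra_simps)
  also have "\<dots> = ((N + 1)\<^sup>2 + (N + 1)) * P1"
    using B by algebra
  also have "\<dots> = smult (real n ^ 2 + real n) P1"
    by (simp add: Suc N_def of_nat_poly power2_eq_square one_pCons algebra_simps smult_add_left)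
  finally show ?thesis
    by (simp add: X_def P1_def Suc numeral_poly one_pCons)
qed

section \<open>Degrees, Legendre expansions and explicit values\<close>

lemma degree_Le: "degree (Le n) = n \<and> Le n \<noteq> 0"
proof (induction n rule: induct_nat_012)
  case (ge2 n)
  have "degree (of_nat (2 * n + 3) * [:0, 1:] * Le (Suc n)) = n + 2"
    using ge2 by (simp add: degree_mult_eq of_nat_poly del: of_nat_add of_nat_mult of_nat_Suc)
  moreover have "degree (of_nat (n + 1) * Le n) < n + 2"
    using ge2 by (simp add: degree_mult_eq of_nat_poly del: of_nat_add of_nat_Suc)
  ultimately have "degree (of_nat (n + 2) * Le (n + 2)) = n + 2"
    unfolding Le_recurrence diff_conv_add_uminus
    by (subst degree_add_eq_left) (simp_all del: of_nat_add of_nat_mult of_nat_Suc)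
  moreover have "degree (of_nat (n + 2) * Le (n + 2)) = degree (Le (n + 2))"
    by (cases "Le (n + 2) = 0") (simp_all add: degree_mult_eq of_nat_poly del: of_nat_add)
  ultimately show ?case
    by (metis add_2_eq_Suc' degree_0 nat.distinct(1))
qed auto

lemma Le_expansion:
  assumes "degree p \<le> n"
  obtains a where "p = (\<Sum>k\<le>n. smult (a k) (Le k))"
proof -
  have "\<exists>a. p = (\<Sum>k\<le>n. smult (a k) (Le k))"
    using assms
  proof (induction n arbitrary: p)
    case 0
    then obtain c where "p = [:c:]"
      using degree_eq_zeroE by blast
    then show ?case
      by (intro exI[of _ "\<lambda>_. c"]) (simp add: one_pCons)
  next
    case (Suc n)
    define c where "c = coeff p (Suc n) / lead_coeff (Le (Suc n))"
    have lc: "coeff (Le (Suc n)) (Suc n) \<noteq> 0" "degree (Le (Suc n)) = Suc n"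
      using degree_Le[of "Suc n"] leading_coeff_0_iff[of "Le (Suc n)"] by auto
    have "degree (p - smult c (Le (Suc n))) \<le> n"
    proof (rule degree_le, intro allI impI)
      fix i assume "n < i"
      then consider "i = Suc n" | "Suc n < i"
        by linarith
      then show "coeff (p - smult c (Le (Suc n))) i = 0"
        by cases (use Suc.prems lc in \<open>auto simp: c_def coeff_eq_0\<close>)
    qed
    then obtain a where a: "p - smult c (Le (Suc n)) = (\<Sum>k\<le>n. smult (a k) (Le k))"
      using Suc.IH by blast
    have "p = (\<Sum>k\<le>Suc n. smult ((a(Suc n := c)) k) (Le k))"
      using a by (simp add: diff_eq_eq)
    then show ?case
      by blast
  qed
  then show ?thesis
    using that by blast
qed

lemma Le_2: "Le 2 = [:-1/2, 0, 3/2:]"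
  and Le_4: "Le 4 = [:3/8, 0, -30/8, 0, 35/8:]"
  and Le_6: "Le 6 = [:-5/16, 0, 105/16, 0, -315/16, 0, 231/16:]"
proof -
  have step: "Le k = q"
    if "k = n + 2" "m = n + 1"
      and "smult (real (2 * n + 3)) ([:0, 1:] * Le m) - smult (real (n + 1)) (Le n) = smult (real k) q"
    for k m n q
  proof -
    have "smult (real k) (Le k) = smult (real k) q"
      using Le_recurrence[of n] that by (simp add: of_nat_poly del: of_nat_add of_nat_Suc)
    then have "smult (1 / real k) (smult (real k) (Le k)) = smult (1 / real k) (smult (real k) q)"
      by simp
    moreover have "real k \<noteq> 0"
      using that(1) by simp
    ultimately show ?thesis
      by simp
  qed
  show L2: "Le 2 = [:-1/2, 0, 3/2:]"
    by (rule step[of 2 0 1]) (simp_all add: one_pCons)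
  have L3: "Le 3 = [:0, -3/2, 0, 5/2:]"
    by (rule step[of 3 1 2]) (simp_all add: L2)
  show L4: "Le 4 = [:3/8, 0, -30/8, 0, 35/8:]"
    by (rule step[of 4 2 3]) (simp_all add: L2 L3)
  have L5: "Le 5 = [:0, 15/8, 0, -70/8, 0, 63/8:]"
    by (rule step[of 5 3 4]) (simp_all add: L3 L4)
  show "Le 6 = [:-5/16, 0, 105/16, 0, -315/16, 0, 231/16:]"
    by (rule step[of 6 4 5]) (simp_all add: L4 L5)
qed

text \<open>The operator \<open>T\<close> that the Legendre polynomials diagonalize. The coefficient
  type is general because zeros are studied over the complex numbers.\<close>

definition legendre_op :: "'a \<Rightarrow> 'a::idom poly \<Rightarrow> 'a poly" where
  "legendre_op \<beta> p = [:-1, 0, 1:] * pderiv (pderiv p) + [:0, 2:] * pderiv p + smult \<beta> p"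


lemma legendre_op_Le:
  "legendre_op \<beta> (Le k) = smult (real k ^ 2 + real k + \<beta>) (Le k)"
  by (simp only: legendre_op_def Le_ode smult_add_left)

lemma legendre_op_sum_Le:
  "legendre_op \<beta> (\<Sum>k\<le>n. smult (a k) (Le k))
     = (\<Sum>k\<le>n. smult (a k * (real k ^ 2 + real k + \<beta>)) (Le k))"
proof -
  have add: "legendre_op \<beta> (p + q) = legendre_op \<beta> p + legendre_op \<beta> q" for p q :: "real poly"
    by (simp add: legendre_op_def pderiv_add algebra_simps smult_add_right)
  have smult: "legendre_op \<beta> (smult c p) = smult c (legendre_op \<beta> p)" for c and p :: "real poly"
    by (simp add: legendre_op_def pderiv_smult smult_add_right smult_diff_right mult.commute)
  show ?thesis
    by (induction n) (simp_all add: add smult legendre_op_Le del: Le_0)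
qed

section \<open>Real polynomials with only real zeros\<close>

abbreviation cpoly :: "real poly \<Rightarrow> complex poly" where
  "cpoly \<equiv> map_poly complex_of_real"

lemma cpoly_add: "cpoly (p + q) = cpoly p + cpoly q"
  by (intro poly_eqI) (simp add: coeff_map_poly)

lemma cpoly_mult: "cpoly (p * q) = cpoly p * cpoly q"
  by (intro poly_eqI) (simp add: coeff_map_poly coeff_mult)

lemma cpoly_smult: "cpoly (smult c p) = smult (of_real c) (cpoly p)"
  by (intro poly_eqI) (simp add: coeff_map_poly)

lemma cpoly_pderiv: "cpoly (pderiv p) = pderiv (cpoly p)"
  by (intro poly_eqI) (simp add: coeff_map_poly coeff_pderiv)

lemma cpoly_legendre_op: "cpoly (legendre_op \<beta> p) = legendre_op (of_real \<beta>) (cpoly p)"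
  unfolding legendre_op_def cpoly_add cpoly_mult cpoly_smult cpoly_pderiv
  by (simp add: map_poly_pCons)

lemma degree_cpoly: "degree (cpoly p) = degree p"
  by (simp add: degree_map_poly)

lemma poly_cpoly_of_real: "poly (cpoly p) (of_real x) = of_real (poly p x)"
  by (induction p) (simp_all add: map_poly_pCons)

lemma poly_cpoly_cnj: "poly (cpoly p) (cnj z) = cnj (poly (cpoly p) z)"
  by (induction p) (simp_all add: map_poly_pCons)

lemma complex_poly_root_exists:
  fixes p :: "complex poly"
  assumes "degree p > 0"
  obtains z where "poly p z = 0"
  using fundamental_theorem_of_algebra[of p] assms constant_degree[of p] by auto

lemma only_real_zeros_multD:
  assumes "only_real_zeros (p * q)" "p \<noteq> 0"
  shows "only_real_zeros q"
  using assms by (auto simp: only_real_zeros_def cpoly_mult)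

lemma only_real_zeros_linear_factor:
  assumes "only_real_zeros p" "degree p > 0"
  obtains r q where "p = [:- r, 1:] * q" "only_real_zeros q" "degree q < degree p"
proof -
  obtain z where z: "poly (cpoly p) z = 0"
    using complex_poly_root_exists[of "cpoly p"] assms(2) by (auto simp: degree_cpoly)
  have "p \<noteq> 0"
    using assms(2) by auto
  then have "Im z = 0"
    using assms(1) z by (auto simp: only_real_zeros_def)
  then have "z = of_real (Re z)"
    by (simp add: complex_eq_iff)
  then have "poly p (Re z) = 0"
    using z poly_cpoly_of_real[of p "Re z"] by simp
  then obtain q where q: "p = [:- Re z, 1:] * q"
    by (auto simp: poly_eq_0_iff_dvd elim: dvdE)
  moreover have "only_real_zeros q"
    using assms(1) unfolding q by (rule only_real_zeros_multD) simp
  moreover have "degree q < degree p"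
    using \<open>p \<noteq> 0\<close> by (subst q, subst degree_mult_eq) (auto simp: q)
  ultimately show ?thesis
    using that by blast
qed

text \<open>Away from zeros this says that \<open>p'/p\<close> decreases. Splitting off one linear
  factor at a time gives a division-free induction.\<close>

lemma laguerre_inequality:
  assumes "only_real_zeros p"
  shows "poly p x * poly (pderiv (pderiv p)) x \<le> (poly (pderiv p) x)\<^sup>2"
  using assms
proof (induction "degree p" arbitrary: p rule: less_induct)
  case less
  show ?case
  proof (cases "degree p = 0")
    case True
    then show ?thesis
      by (auto elim!: degree_eq_zeroE simp: pderiv_pCons)
  next
    case False
    then obtain r q where p: "p = [:- r, 1:] * q" and "only_real_zeros q" "degree q < degree p"
      using only_real_zeros_linear_factor less.prems by blast
    then have IH: "poly q x * poly (pderiv (pderiv q)) x \<le> (poly (pderiv q) x)\<^sup>2"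
      using less.hyps by blast
    have p': "poly (pderiv p) x = poly q x + (x - r) * poly (pderiv q) x"
      and p'': "poly (pderiv (pderiv p)) x = 2 * poly (pderiv q) x + (x - r) * poly (pderiv (pderiv q)) x"
      unfolding p pderiv_mult pderiv_add by (simp_all add: pderiv_pCons algebra_simps)
    have "(poly (pderiv p) x)\<^sup>2 - poly p x * poly (pderiv (pderiv p)) x
      = (poly q x)\<^sup>2 + (x - r)\<^sup>2 * ((poly (pderiv q) x)\<^sup>2 - poly q x * poly (pderiv (pderiv q)) x)"
      unfolding p' p'' by (simp add: p power2_eq_square algebra_simps)
    also have "\<dots> \<ge> 0"
      using IH by (intro add_nonneg_nonneg mult_nonneg_nonneg) auto
    finally show ?thesis
      by simp
  qed
qed

lemma discriminant_nonneg:
  assumes "only_real_zeros [:c, b, a:]"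
  shows "4 * (a * c) \<le> b\<^sup>2"
proof (cases "a = 0")
  case False
  \<comment> \<open>At the vertex the derivative vanishes, so Laguerre's inequality there is the
    discriminant condition.\<close>
  define v where "v = - b / (2 * a)"
  have v: "b + 2 * a * v = 0"
    using False by (simp add: v_def)
  have "(c + v * (b + v * a)) * (2 * a) \<le> (b + 2 * a * v)\<^sup>2"
    using laguerre_inequality[OF assms, of v] by (simp add: pderiv_pCons algebra_simps)
  then have "(c + v * (b + v * a)) * (2 * a) \<le> 0"
    by (simp add: v)
  moreover have "2 * ((c + v * (b + v * a)) * (2 * a)) = 4 * (a * c) - b\<^sup>2"
    using v by algebra
  ultimately show ?thesis
    by linarith
qed simp

section \<open>The Legendre operator preserves real-rootedness\<close>

lemma Im_inverse_neg: "Im (inverse z) < 0 \<longleftrightarrow> Im z > 0"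
proof (cases "z = 0")
  case False
  then have "(Re z)\<^sup>2 + (Im z)\<^sup>2 > 0"
    by (simp add: complex_neq_0)
  then show ?thesis
    by (simp add: zero_less_divide_iff)
qed simp

text \<open>\<open>p'/p\<close> is the sum of \<open>1 / (z - r)\<close> over the zeros r, and each
  \<open>z - r\<close> lies in the upper half-plane, which inversion maps to the lower one.\<close>

lemma Im_log_deriv_neg:
  fixes p :: "complex poly"
  assumes "degree p > 0" and "\<And>y. poly p y = 0 \<Longrightarrow> Im y \<le> 0" and "Im z > 0"
  shows "Im (poly (pderiv p) z / poly p z) < 0"
  using assms(1,2)
proof (induction "degree p" arbitrary: p rule: less_induct)
  case less
  obtain r where r: "poly p r = 0"
    using complex_poly_root_exists less.prems(1) by blast
  then obtain q where p: "p = [:- r, 1:] * q"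
    by (auto simp: poly_eq_0_iff_dvd elim: dvdE)
  have "q \<noteq> 0"
    using less.prems(1) by (auto simp: p)
  then have deg: "degree p = Suc (degree q)"
    unfolding p by (subst degree_mult_eq) auto
  have q_roots: "Im y \<le> 0" if "poly q y = 0" for y
    using less.prems(2)[of y] that by (simp add: p)
  have "Im r \<le> 0"
    using r less.prems(2) by blast
  then have "Im (z - r) > 0"
    using assms(3) by simp
  then have r_neg: "Im (inverse (z - r)) < 0"
    by (simp only: Im_inverse_neg)
  have nz: "z - r \<noteq> 0" "poly q z \<noteq> 0"
    using \<open>Im (z - r) > 0\<close> q_roots[of z] assms(3) by auto
  have "poly (pderiv p) z / poly p z = inverse (z - r) + poly (pderiv q) z / poly q z"
    unfolding p pderiv_mult using nz by (simp add: pderiv_pCons field_simps)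
  moreover have "Im (poly (pderiv q) z / poly q z) \<le> 0"
  proof (cases "degree q = 0")
    case True
    then show ?thesis
      by (auto elim!: degree_eq_zeroE simp: pderiv_pCons)
  next
    case False
    then show ?thesis
      using less.hyps[of q] q_roots deg by fastforce
  qed
  ultimately show ?case
    using r_neg by simp
qed

text \<open>With \<open>v = 1 / s\<close> the claim concerns
  \<open>(z + \<beta> v) / (z\<^sup>2 + z v - 1)\<close>; the partial fractions
  \<open>(z + \<beta> v) / (z (z + v)) = \<beta> / z + (1 - \<beta>) / (z + v)\<close> are where
  \<open>0 \<le> \<beta> \<le> 1\<close> enters.\<close>
lemma Im_symbol_quotient_neg:
  fixes z s :: complex and \<beta> :: real
  assumes z: "Im z > 0" and s: "Im s < 0" and \<beta>: "0 \<le> \<beta>" "\<beta> \<le> 1"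
  shows "Im ((z * s + \<beta>) / ((z\<^sup>2 - 1) * s + z)) < 0"
proof -
  define v where "v = inverse s"
  have "s \<noteq> 0"
    using s by auto
  have v: "Im v > 0"
    using s Im_inverse_neg[of v] by (simp add: v_def)
  have zv: "Im (z + v) > 0" and zbv: "Im (z + \<beta> * v) > 0"
    using z v \<beta> by (simp_all add: add_pos_nonneg)
  have nz: "z \<noteq> 0" "z + v \<noteq> 0" "z + \<beta> * v \<noteq> 0"
    using z zv zbv by (metis less_irrefl zero_complex.simps(2))+
  have "Im (\<beta> * inverse z + (1 - \<beta>) * inverse (z + v)) < 0"
  proof -
    have "Im (inverse z) < 0" "Im (inverse (z + v)) < 0"
      using z zv by (simp_all only: Im_inverse_neg)
    moreover have "\<beta> * x + (1 - \<beta>) * y < 0" if "x < 0" "y < 0" for x y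
      using \<beta> that
      by (cases "\<beta> = 0") (auto intro!: add_neg_nonpos simp: mult_pos_neg mult_nonneg_nonpos)
    moreover have "Im (\<beta> * w + (1 - \<beta>) * w') = \<beta> * Im w + (1 - \<beta>) * Im w'" for w w' :: complex
      by simp
    ultimately show ?thesis
      by presburger
  qed
  also have "\<beta> * inverse z + (1 - \<beta>) * inverse (z + v) = inverse (z * (z + v) / (z + \<beta> * v))"
    using nz by (simp add: field_simps)
  finally have "Im (z * (z + v) / (z + \<beta> * v)) > 0"
    by (simp only: Im_inverse_neg)
  \<comment> \<open>The reciprocal of the target is the quotient just bounded minus
    \<open>inverse (z + \<beta> * v)\<close>; both contributions have positive imaginary part, and
    one more inversion finishes.\<close>
  moreover have "Im (inverse (z + \<beta> * v)) < 0"
    using zbv by (simp only: Im_inverse_neg)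
  ultimately have "Im (z * (z + v) / (z + \<beta> * v) - inverse (z + \<beta> * v)) > 0"
    by simp
  then have "Im (inverse (z * (z + v) / (z + \<beta> * v) - inverse (z + \<beta> * v))) < 0"
    by (simp only: Im_inverse_neg)
  also have "z * (z + v) / (z + \<beta> * v) - inverse (z + \<beta> * v)
      = (z * (z + v) - 1) / (z + \<beta> * v)"
    by (simp add: diff_divide_distrib inverse_eq_divide)
  also have "inverse ((z * (z + v) - 1) / (z + \<beta> * v)) = (z * s + \<beta>) / ((z\<^sup>2 - 1) * s + z)"
  proof -
    have "z * s + \<beta> = s * (z + \<beta> * v)" "(z\<^sup>2 - 1) * s + z = s * (z * (z + v) - 1)"
      using \<open>s \<noteq> 0\<close> by (simp_all add: v_def power2_eq_square field_simps)
    then show ?thesis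
      using \<open>s \<noteq> 0\<close> by simp
  qed
  finally show ?thesis .
qed

text \<open>Freezing \<open>z\<close> in the coefficients, the first-order operator \<open>(z\<^sup>2 - 1) D + z\<close> maps \<open>p\<close> to a
  polynomial \<open>R\<close> without zeros in the upper half-plane, and the value at \<open>z\<close> of the Legendre
  operator applied to \<open>p\<close> is \<open>R' + z p' + \<beta> p\<close>. After division by \<open>R\<close> both summands lie in the
  lower half-plane.\<close>
lemma legendre_op_nonzero_upper:
  fixes p :: "complex poly" and \<beta> :: real
  assumes deg: "degree p > 0" and roots: "\<And>y. poly p y = 0 \<Longrightarrow> Im y \<le> 0"
    and z: "Im z > 0" and \<beta>: "0 \<le> \<beta>" "\<beta> \<le> 1"
  shows "poly (legendre_op (of_real \<beta>) p) z \<noteq> 0"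
proof
  assume eq0: "poly (legendre_op (of_real \<beta>) p) z = 0"
  define A where "A = z\<^sup>2 - 1"
  define R where "R = smult A (pderiv p) + smult z p"
  have z0: "z \<noteq> 0"
    using z by auto
  have log_deriv: "Im (poly (pderiv p) y / poly p y) < 0" "poly p y \<noteq> 0" if "Im y > 0" for y
    using Im_log_deriv_neg[OF deg roots that] roots[of y] that by auto
  have R_eq: "poly R y = poly p y * (A * (poly (pderiv p) y / poly p y) + z)" if "Im y > 0" for y
    using log_deriv(2)[OF that] by (simp add: R_def field_simps)
  \<comment> \<open>A zero denominator would make the quotient 0 by convention, contradicting the
    strict inequality.\<close>
  have symbol_nz: "A * s + z \<noteq> 0" if "Im s < 0" for s
    using Im_symbol_quotient_neg[OF z that \<beta>] by (auto simp: A_def)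
  have R_roots: "Im y \<le> 0" if "poly R y = 0" for y
    using that R_eq[of y] log_deriv[of y] symbol_nz by (metis mult_eq_0_iff not_le)
  \<comment> \<open>\<open>R\<close> must have positive degree for its logarithmic derivative to be
    strictly in the lower half-plane.\<close>
  have "degree (smult A (pderiv p)) < degree (smult z p)"
    using deg z0 by (simp add: degree_pderiv)
  then have "degree R = degree p"
    using z0 by (simp add: R_def degree_add_eq_right)
  then have 1: "Im (poly (pderiv R) z / poly R z) < 0"
    using Im_log_deriv_neg[of R z] deg R_roots z by simp
  define s where "s = poly (pderiv p) z / poly p z"
  have 2: "Im ((z * s + \<beta>) / (A * s + z)) < 0"
    unfolding A_def s_def by (rule Im_symbol_quotient_neg[OF z log_deriv(1)[OF z] \<beta>])
  have pz: "poly p z \<noteq> 0"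
    using log_deriv(2)[OF z] .
  have Rz: "poly R z = poly p z * (A * s + z)"
    using R_eq[OF z] by (simp add: s_def)
  have "(z * s + \<beta>) / (A * s + z) = (z * poly (pderiv p) z + \<beta> * poly p z) / poly R z"
  proof -
    have "z * poly (pderiv p) z + \<beta> * poly p z = poly p z * (z * s + \<beta>)"
      using pz by (simp add: s_def field_simps)
    then show ?thesis
      using pz by (simp add: Rz)
  qed
  then have "poly (pderiv R) z / poly R z + (z * s + \<beta>) / (A * s + z)
      = (poly (pderiv R) z + (z * poly (pderiv p) z + \<beta> * poly p z)) / poly R z"
    by (simp add: add_divide_distrib)
  also have "poly (pderiv R) z + (z * poly (pderiv p) z + \<beta> * poly p z)
      = poly (legendre_op (of_real \<beta>) p) z"
    by (simp add: R_def A_def legendre_op_def pderiv_add pderiv_smult algebra_simps power2_eq_square)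
  finally have "Im (poly (pderiv R) z / poly R z + (z * s + \<beta>) / (A * s + z)) = 0"
    by (simp add: eq0)
  with 1 2 show False
    by simp
qed

lemma only_real_zeros_legendre_op:
  assumes p: "only_real_zeros p" and \<beta>: "0 \<le> \<beta>" "\<beta> \<le> 1"
  shows "only_real_zeros (legendre_op \<beta> p)"
proof (cases "degree p = 0")
  case True
  then obtain c where "p = [:c:]"
    using degree_eq_zeroE by blast
  then show ?thesis
    by (auto simp: legendre_op_def only_real_zeros_def pderiv_pCons map_poly_pCons)
next
  case False
  have roots: "Im y \<le> 0" if "poly (cpoly p) y = 0" for y
    using p False that by (auto simp: only_real_zeros_def)
  have upper: "poly (cpoly (legendre_op \<beta> p)) z \<noteq> 0" if "Im z > 0" for z
    unfolding cpoly_legendre_op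
    using legendre_op_nonzero_upper[of "cpoly p" z \<beta>] roots that \<beta> False by (simp add: degree_cpoly)
  \<comment> \<open>Real coefficients make the zeros symmetric under conjugation, so the lower
    half-plane is excluded too.\<close>
  have "Im z = 0" if "poly (cpoly (legendre_op \<beta> p)) z = 0" for z
    using upper[of z] upper[of "cnj z"] that by (force simp: poly_cpoly_cnj)
  then show ?thesis
    by (simp add: only_real_zeros_def)
qed

section \<open>Necessity\<close>

text \<open>Since every polynomial has a Legendre expansion, the condition on coefficients becomes
  one on \<open>T\<close> acting on all polynomials.\<close>

lemma multiplier_imp_op_preserves:
  assumes "legendre_multiplier_sequence (\<lambda>k. real k ^ 2 + real k + \<beta>)" and "only_real_zeros p"
  shows "only_real_zeros (legendre_op \<beta> p)"
proof -
  obtain a where "p = (\<Sum>k\<le>degree p. smult (a k) (Le k))"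
    using Le_expansion[of p "degree p"] by auto
  then show ?thesis
    using assms legendre_op_sum_Le[of \<beta> a "degree p"]
    unfolding legendre_multiplier_sequence_def by metis
qed

text \<open>The test polynomial is \<open>x\<^sup>6\<close>: its image \<open>q\<close> is even, with
  \<open>q(0) = -32/231 (\<alpha> - 1)\<close> and \<open>q''(0) = -240/231 (\<alpha> - 1)\<close>, which have the same sign.\<close>
lemma multiplier_imp_alpha_eq_1:
  assumes "legendre_multiplier_sequence (\<lambda>k. real k ^ 2 + \<alpha> * real k + \<beta>)"
  shows "\<alpha> = 1"
proof -
  \<comment> \<open>These are the Legendre coefficients of \<open>x^6\<close>.\<close>
  define a :: "nat \<Rightarrow> real" where "a = (\<lambda>_. 0)(0 := 1/7, 2 := 10/21, 4 := 24/77, 6 := 16/231)"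
  define q where "q = (\<Sum>k\<le>6. smult (a k * (real k ^ 2 + \<alpha> * real k + \<beta>)) (Le k))"
  have sum6: "(\<Sum>k\<le>6. f k) = f 0 + f 1 + f 2 + f 3 + f 4 + f 5 + f 6" for f :: "nat \<Rightarrow> real poly"
    by (simp add: eval_nat_numeral)
  have "(\<Sum>k\<le>6. smult (a k) (Le k)) = monom 1 6"
  proof -
    have "monom 1 6 = [:0, 0, 0, 0, 0, 0, 1 :: real:]"
      by (simp add: monom_altdef eval_nat_numeral)
    then show ?thesis
      by (simp add: sum6 a_def Le_2 Le_4 Le_6 one_pCons)
  qed
  moreover have "only_real_zeros (monom 1 6)"
    by (auto simp: only_real_zeros_def map_poly_monom poly_monom)
  ultimately have "only_real_zeros q"
    using assms[unfolded legendre_multiplier_sequence_def, rule_format, of a 6] by (simp add: q_def)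
  from laguerre_inequality[OF this, of 0]
  have "coeff q 0 * (2 * coeff q 2) \<le> (coeff q 1)\<^sup>2"
    by (simp add: poly_0_coeff_0 coeff_pderiv numeral_2_eq_2)
  moreover have "coeff q 0 = - 32 / 231 * (\<alpha> - 1)" "coeff q 1 = 0" "coeff q 2 = - 120 / 231 * (\<alpha> - 1)"
  proof -
    have "q = [:\<beta> / 7:] + smult (10 / 21 * (4 + \<alpha> * 2 + \<beta>)) [:-1/2, 0, 3/2:]
        + smult (24 / 77 * (16 + \<alpha> * 4 + \<beta>)) [:3/8, 0, -30/8, 0, 35/8:]
        + smult (16 / 231 * (36 + \<alpha> * 6 + \<beta>)) [:-5/16, 0, 105/16, 0, -315/16, 0, 231/16:]"
      by (simp add: q_def sum6 a_def Le_2 Le_4 Le_6 one_pCons)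
    then show "coeff q 0 = - 32 / 231 * (\<alpha> - 1)" "coeff q 1 = 0" "coeff q 2 = - 120 / 231 * (\<alpha> - 1)"
      by (simp_all add: numeral_2_eq_2 field_simps)
  qed
  ultimately have "(\<alpha> - 1)\<^sup>2 \<le> 0"
    by (simp add: power2_eq_square algebra_simps)
  then show ?thesis
    by simp
qed

text \<open>For negative \<beta>, the image of \<open>x^2 - c^2\<close> with a suitable c has
  nonreal zeros unless \<open>\<beta> = -6\<close>, where its leading term vanishes; the cubic
  handles that value.\<close>

lemma op_preserves_imp_nonneg:
  assumes "\<And>p. only_real_zeros p \<Longrightarrow> only_real_zeros (legendre_op \<beta> p)"
  shows "\<beta> \<ge> 0"
proof (rule ccontr)
  assume neg: "\<not> \<beta> \<ge> 0"
  have quad: "only_real_zeros [:- (c\<^sup>2), 0, 1:]" for c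
  proof -
    have "poly (cpoly [:- (c\<^sup>2), 0, 1:]) z = (z - of_real c) * (z + of_real c)" for z
      by (simp add: map_poly_pCons power2_eq_square algebra_simps)
    then show ?thesis
      by (auto simp: only_real_zeros_def eq_neg_iff_add_eq_0[symmetric])
  qed
  have cubic: "only_real_zeros ([:0, 1:] * [:- (c\<^sup>2), 0, 1:])" for c
    using quad[of c] by (auto simp: only_real_zeros_def cpoly_mult map_poly_pCons)
  have "legendre_op \<beta> [:- (c\<^sup>2), 0, 1:] = [:- 2 - \<beta> * c\<^sup>2, 0, 6 + \<beta>:]" for c
    by (simp add: legendre_op_def pderiv_pCons algebra_simps)
  then have quad_ineq: "(6 + \<beta>) * (- 2 - \<beta> * c\<^sup>2) \<le> 0" for c
    using discriminant_nonneg[of "- 2 - \<beta> * c\<^sup>2" 0 "6 + \<beta>"] assms[OF quad[of c]]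
    by (simp del: distrib_left_numeral distrib_right_numeral)
  have "legendre_op \<beta> ([:0, 1:] * [:- (c\<^sup>2), 0, 1:])
      = [:0, 1:] * [:- 6 - (2 + \<beta>) * c\<^sup>2, 0, 12 + \<beta>:]" for c
    by (simp add: legendre_op_def pderiv_pCons algebra_simps)
  then have "only_real_zeros [:- 6 - (2 + \<beta>) * c\<^sup>2, 0, 12 + \<beta>:]" for c
    using assms[OF cubic[of c]] only_real_zeros_multD[of "[:0, 1:]"] by simp
  then have cubic_ineq: "(12 + \<beta>) * (- 6 - (2 + \<beta>) * c\<^sup>2) \<le> 0" for c
    using discriminant_nonneg[of "- 6 - (2 + \<beta>) * c\<^sup>2" 0 "12 + \<beta>"] by simp
  have "\<beta> \<ge> - 6"
    using quad_ineq[of 0] by simp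
  moreover have "\<beta> \<le> - 6"
  proof (rule ccontr)
    assume "\<not> \<beta> \<le> - 6"
    \<comment> \<open>This c makes \<open>\<beta> * c^2 = -3\<close>, so the left side equals
      1.\<close>
    then have "- 2 - \<beta> * (sqrt (3 / (- \<beta>)))\<^sup>2 \<le> 0"
      using quad_ineq[of "sqrt (3 / (- \<beta>))"] by (simp add: mult_le_0_iff)
    then show False
      using neg by (simp add: field_simps)
  qed
  ultimately have "\<beta> = - 6"
    by simp
  then show False
    \<comment> \<open>At \<open>\<beta> = -6\<close> and \<open>c = 2\<close> the left side is
      \<open>6 * 10\<close>.\<close>
    using cubic_ineq[of 2] by simp
qed

text \<open>The test polynomials are \<open>(x - c)\<^sup>n\<close> with \<open>n \<beta> > n + \<beta>\<close> and \<open>c\<close> large.\<close>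
lemma op_preserves_imp_le_1:
  assumes "\<And>p. only_real_zeros p \<Longrightarrow> only_real_zeros (legendre_op \<beta> p)"
  shows "\<beta> \<le> 1"
proof (rule ccontr)
  assume "\<not> \<beta> \<le> 1"
  then have \<beta>: "\<beta> > 1"
    by simp
  obtain m :: nat where m: "real m > \<beta> / (\<beta> - 1)"
    using reals_Archimedean2 by blast
  define n where "n = real (m + 2)"
  have n: "n \<ge> 2" "n * \<beta> - n - \<beta> > 0"
    using m \<beta> by (simp_all add: n_def field_simps)
  \<comment> \<open>The discriminant below is nonnegative only if
    \<open>c^2 * (n * \<beta> - n - \<beta>)\<close> is at most
    \<open>(n^2 + n + \<beta>) * (n - 1)\<close>; this c replaces \<open>n - 1\<close> by n and so
    exceeds the bound.\<close>
  define c where "c = sqrt ((n\<^sup>2 + n + \<beta>) * n / (n * \<beta> - n - \<beta>))"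
  have c: "c\<^sup>2 * (n * \<beta> - n - \<beta>) = (n\<^sup>2 + n + \<beta>) * n"
    using n \<beta> by (simp add: c_def)
  define l where "l = [:- c, 1:]"
  have "cpoly (l ^ k) = (cpoly l) ^ k" for k
    by (induction k) (simp_all add: cpoly_mult)
  then have "only_real_zeros (l ^ k)" for k
    by (auto simp: only_real_zeros_def l_def map_poly_pCons)
  then have "only_real_zeros (legendre_op \<beta> (l ^ (m + 2)))"
    by (intro assms)
  \<comment> \<open>Two derivatives leave the factor \<open>l ^ m\<close>, so only the quadratic
    cofactor has to be examined.\<close>
  moreover have "legendre_op \<beta> (l ^ (m + 2)) =
      l ^ m * [:\<beta> * c\<^sup>2 - n * (n - 1), - 2 * c * (n + \<beta>), n\<^sup>2 + n + \<beta>:]"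
  proof -
    have l': "pderiv l = 1"
      by (simp add: l_def pderiv_pCons one_pCons)
    have d: "pderiv (l ^ Suc k) = smult (real (Suc k)) (l ^ k)" for k
      by (simp only: pderiv_power_Suc l' mult_1_right)
    have d1: "pderiv (l ^ (m + 2)) = smult n (l ^ Suc m)"
      using d[of "Suc m"] by (simp add: n_def del: power_Suc)
    have d2: "pderiv (pderiv (l ^ (m + 2))) = smult (n * (n - 1)) (l ^ m)"
      unfolding d1 pderiv_smult d by (simp add: n_def)
    have "legendre_op \<beta> (l ^ (m + 2))
        = l ^ m * (smult (n * (n - 1)) [:-1, 0, 1:] + smult n ([:0, 2:] * l) + smult \<beta> (l * l))"
      unfolding legendre_op_def d2 unfolding d1
      by (simp only: distrib_left mult_smult_left mult_smult_right power_Suc power_add power2_eq_square ac_simps)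
    then show ?thesis
      by (simp add: l_def algebra_simps power2_eq_square)
  qed
  moreover have "l ^ m \<noteq> 0"
    by (simp add: l_def)
  ultimately have "only_real_zeros [:\<beta> * c\<^sup>2 - n * (n - 1), - 2 * c * (n + \<beta>), n\<^sup>2 + n + \<beta>:]"
    using only_real_zeros_multD by metis
  then have "4 * ((n\<^sup>2 + n + \<beta>) * (\<beta> * c\<^sup>2 - n * (n - 1))) \<le> (- 2 * c * (n + \<beta>))\<^sup>2"
    by (rule discriminant_nonneg)
  also have "(- 2 * c * (n + \<beta>))\<^sup>2 = 4 * ((n\<^sup>2 + n + \<beta>) * (\<beta> * c\<^sup>2 - n * (n - 1)))
      - 4 * n * (c\<^sup>2 * (n * \<beta> - n - \<beta>) - (n\<^sup>2 + n + \<beta>) * (n - 1))"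
    by (simp add: power2_eq_square algebra_simps)
  also have "c\<^sup>2 * (n * \<beta> - n - \<beta>) - (n\<^sup>2 + n + \<beta>) * (n - 1) = n\<^sup>2 + n + \<beta>"
    unfolding c by (simp add: algebra_simps)
  finally have "4 * n * (n\<^sup>2 + n + \<beta>) \<le> 0"
    by simp
  moreover have "4 * n * (n\<^sup>2 + n + \<beta>) > 0"
    using n \<beta> by (intro mult_pos_pos add_pos_pos) auto
  ultimately show False
    by simp
qed

theorem theorem4p10:
  fixes \<alpha> \<beta> :: real
  shows "legendre_multiplier_sequence (\<lambda>k. real k ^ 2 + \<alpha> * real k + \<beta>)
           \<longleftrightarrow> \<alpha> = 1 \<and> 0 \<le> \<beta> \<and> \<beta> \<le> 1"
proof
  assume *: "legendre_multiplier_sequence (\<lambda>k. real k ^ 2 + \<alpha> * real k + \<beta>)"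
  then have \<alpha>: "\<alpha> = 1"
    by (rule multiplier_imp_alpha_eq_1)
  then have "only_real_zeros (legendre_op \<beta> p)" if "only_real_zeros p" for p
    using multiplier_imp_op_preserves * that by simp
  then show "\<alpha> = 1 \<and> 0 \<le> \<beta> \<and> \<beta> \<le> 1"
    using \<alpha> op_preserves_imp_nonneg op_preserves_imp_le_1 by blast
next
  assume "\<alpha> = 1 \<and> 0 \<le> \<beta> \<and> \<beta> \<le> 1"
  then show "legendre_multiplier_sequence (\<lambda>k. real k ^ 2 + \<alpha> * real k + \<beta>)"
    \<comment> \<open>For \<open>\<alpha> = 1\<close> the sum with multiplied coefficients is the
      image under \<open>T\<close> of the original sum.\<close>
    using only_real_zeros_legendre_op[of _ \<beta>]
    by (simp add: legendre_multiplier_sequence_def flip: legendre_op_sum_Le)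
qed

end
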